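(* Let $G_1=(V_1,E_1)$ and $G_2=(V_2,E_2)$ be simple graphs such that the induced subgraphs of $G_1$ and of $G_2$ on $V_1\cap V_2$ are cliques, and let $G=G_1\boxtimes G_2=(V_1\cup V_2,E_1\cup E_2)$ be their clique sum. Then \[ \mathrm{mlt}(G)=\max\{\mathrm{mlt}(G_1),\mathrm{mlt}(G_2)\}. \]
   Context: For a simple graph $H=(V,E)$ with vertex set $V=[N]$, let $\mathrm{Sym}_N$ be the real vector space of real symmetric $N\times N$ matrices. Let $\pi_H:\mathrm{Sym}_N\to \mathbb{R}^{N}\oplus\mathbb{R}^{E}$ be the coordinate projection $(a_{ij})\mapsto \big((a_{ii})_{i\in[N]},(a_{ij})_{\{i,j\}\in E}\big)$. Let $V_r\subset\mathrm{Sym}_N$ be the variety of symmetric matrices of rank at most $r$. The maximum likelihood threshold $\mathrm{mlt}(H)$ is the smallest integer $r$ such that for almost all positive semidefinite $N\times N$ matrices $A$ of rank $r$ there is a positive definite matrix $P$ with $\pi_H(A)=\pi_H(P)$. Here "almost all" means that the set of positive semidefinite rank-$r$ matrices $A$ for which no such $P$ exists is contained in a proper algebraic subvariety of $V_r$. *)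

theory Defs
  imports "HOL-Analysis.Analysis"
begin

definition simple_graph :: "'n set \<Rightarrow> 'n set set \<Rightarrow> bool" where
  "simple_graph V E \<longleftrightarrow> finite V \<and> (\<forall>e\<in>E. e \<subseteq> V \<and> card e = 2)"

definition induces_clique :: "'n set set \<Rightarrow> 'n set \<Rightarrow> bool" where
  "induces_clique E W \<longleftrightarrow> (\<forall>i\<in>W. \<forall>j\<in>W. i \<noteq> j \<longrightarrow> {i, j} \<in> E)"

text \<open>
  All vertex sets are subsets of one finite type \<open>'n\<close>, so that graphs with different, possibly
  overlapping, vertex sets can be combined. A matrix with rows and columns indexed by \<open>V\<close> is a
  matrix over \<open>'n\<close> that is zero outside \<open>V \<times> V\<close>. This padding does not change the rank, and the
  polynomial functions of a padded matrix are exactly those of its \<open>V \<times> V\<close> entries.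
\<close>

definition sym_mats :: "'n set \<Rightarrow> (real^'n^'n) set" where
  "sym_mats V = {A. transpose A = A \<and> (\<forall>i j. i \<notin> V \<or> j \<notin> V \<longrightarrow> A $ i $ j = 0)}"

definition rank_variety :: "'n::finite set \<Rightarrow> nat \<Rightarrow> (real^'n^'n) set" where
  "rank_variety V r = {A \<in> sym_mats V. rank A \<le> r}"

definition pos_semidef :: "'n::finite set \<Rightarrow> real^'n^'n \<Rightarrow> bool" where
  "pos_semidef V A \<longleftrightarrow> A \<in> sym_mats V \<and>
     (\<forall>x. (\<forall>i. i \<notin> V \<longrightarrow> x $ i = 0) \<longrightarrow> 0 \<le> x \<bullet> (A *v x))"

definition pos_def :: "'n::finite set \<Rightarrow> real^'n^'n \<Rightarrow> bool" where
  "pos_def V A \<longleftrightarrow> A \<in> sym_mats V \<and>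
     (\<forall>x. (\<forall>i. i \<notin> V \<longrightarrow> x $ i = 0) \<and> x \<noteq> 0 \<longrightarrow> 0 < x \<bullet> (A *v x))"

text \<open>The entry at an unordered pair of indices; well defined because the matrix is symmetric.\<close>

definition edge_entry :: "real^'n^'n \<Rightarrow> 'n set \<Rightarrow> real" where
  "edge_entry A e = (THE a. \<exists>i j. e = {i, j} \<and> a = A $ i $ j)"

lemma edge_entry_eq:
  assumes "A \<in> sym_mats V"
  shows "edge_entry A {i, j} = A $ i $ j"
proof -
  have "A $ j $ i = transpose A $ i $ j"
    by (simp add: transpose_def)
  then have "A $ j $ i = A $ i $ j"
    using assms by (simp add: sym_mats_def)
  then show ?thesis
    unfolding edge_entry_def
    by (intro the_equality) (auto simp: doubleton_eq_iff)
qed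

definition graph_proj ::
    "'n set \<Rightarrow> 'n set set \<Rightarrow> real^'n^'n \<Rightarrow> ('n \<Rightarrow> real) \<times> ('n set \<Rightarrow> real)" where
  "graph_proj V E A = (\<lambda>i\<in>V. A $ i $ i, \<lambda>e\<in>E. edge_entry A e)"

definition proper_subvariety :: "'v::real_normed_vector set \<Rightarrow> 'v set \<Rightarrow> bool" where
  "proper_subvariety X W \<longleftrightarrow>
     (\<exists>F. (\<forall>f\<in>F. real_polynomial_function f) \<and> X = {x \<in> W. \<forall>f\<in>F. f x = 0}) \<and> X \<noteq> W"

definition almost_all_completable :: "'n::finite set \<Rightarrow> 'n set set \<Rightarrow> nat \<Rightarrow> bool" where
  "almost_all_completable V E r \<longleftrightarrow>
     (\<exists>X. proper_subvariety X (rank_variety V r) \<and>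
       {A. pos_semidef V A \<and> rank A = r \<and>
           \<not> (\<exists>P. pos_def V P \<and> graph_proj V E A = graph_proj V E P)} \<subseteq> X)"

definition mlt :: "'n::finite set \<Rightarrow> 'n set set \<Rightarrow> nat" where
  "mlt V E = (LEAST r. almost_all_completable V E r)"

end

theory Submission imports Defs begin

text \<open>
  Write \<open>V\<^sub>r\<close> for the variety of symmetric matrices of rank at most \<open>r\<close>. Parametrizing \<open>V\<^sub>r\<close> by
  \<open>Q S Q\<^sup>T\<close>, with \<open>Q\<close> having \<open>r\<close> columns, shows that it is irreducible, so finitely many generic
  conditions may be imposed at once. Three facts give the theorem.

  \<^item> Generic completability in rank \<open>r\<close> passes to subgraphs: for a fixed matrix \<open>L = (I | T)\<^sup>T\<close> the map
    \<open>B \<mapsto> L B L\<^sup>T\<close> extends a rank-\<open>r\<close> matrix on the small vertex set to one on the large set, so an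
    equation for the bad matrices pulls back; a suitable \<open>T\<close> keeps it nontrivial.

  \<^item> It passes from \<open>r\<close> to \<open>r + 1\<close>: with \<open>q = x\<^sup>T A x\<close>, the matrix \<open>q A - (A x) (A x)\<^sup>T\<close> is polynomial
    in \<open>A\<close>, positive semidefinite, and of rank one less; any completion of it gives one of \<open>A\<close> after
    adding back the rank-one term and dividing by \<open>q\<close>.

  \<^item> It passes to clique sums: completions on \<open>V\<^sub>1\<close> and \<open>V\<^sub>2\<close> agree on the clique, and two positive
    definite matrices agreeing on \<open>V\<^sub>1 \<inter> V\<^sub>2\<close> are blocks of a positive definite matrix on
    \<open>V\<^sub>1 \<union> V\<^sub>2\<close>.
\<close>

subsection \<open>Coordinate projections and blocks\<close>

text \<open>Encodes supports algebraically: being supported on \<open>V\<close> becomes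
  \<open>coord_proj V ** A = A\<close>, which combines with products and transposes without
  entrywise work.\<close>

definition coord_proj :: "'n::finite set \<Rightarrow> real^'n^'n" where
  "coord_proj V = (\<chi> i j. if i = j \<and> i \<in> V then 1 else 0)"

lemma coord_proj_mult_left: "(coord_proj V ** A) $ i $ j = (if i \<in> V then A $ i $ j else 0)"
proof -
  have "(coord_proj V ** A) $ i $ j = (\<Sum>k\<in>UNIV. if k = i then (if i \<in> V then A $ i $ j else 0) else 0)"
    unfolding matrix_matrix_mult_def coord_proj_def by (simp only: vec_lambda_beta, intro sum.cong) auto
  then show ?thesis by simp
qed

lemma coord_proj_mult_right: "(A ** coord_proj V) $ i $ j = (if j \<in> V then A $ i $ j else 0)"
proof -
  have "(A ** coord_proj V) $ i $ j = (\<Sum>k\<in>UNIV. if k = j then (if j \<in> V then A $ i $ j else 0) else 0)"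
    unfolding matrix_matrix_mult_def coord_proj_def by (simp only: vec_lambda_beta, intro sum.cong) auto
  then show ?thesis by simp
qed

lemma coord_proj_mult_vec: "(coord_proj V *v x) $ i = (if i \<in> V then x $ i else 0)"
proof -
  have "(coord_proj V *v x) $ i = (\<Sum>k\<in>UNIV. if k = i then (if i \<in> V then x $ i else 0) else 0)"
    unfolding matrix_vector_mult_def coord_proj_def by (simp only: vec_lambda_beta, intro sum.cong) auto
  then show ?thesis by simp
qed

lemma coord_proj_nth: "coord_proj V $ i $ j = (if i = j \<and> i \<in> V then 1 else 0)"
  by (simp add: coord_proj_def)

lemma transpose_coord_proj [simp]: "transpose (coord_proj V) = coord_proj V"
  by (auto simp: vec_eq_iff transpose_def coord_proj_def)

lemma coord_proj_mult: "coord_proj V ** coord_proj W = coord_proj (V \<inter> W)"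
  by (auto simp: vec_eq_iff coord_proj_mult_left coord_proj_nth)

lemma coord_proj_idem [simp]: "coord_proj V ** coord_proj V = coord_proj V"
  by (simp add: coord_proj_mult)

lemma transpose_add: "transpose (A + B) = transpose A + transpose (B :: real^'n^'m)"
  by (simp add: vec_eq_iff transpose_def)

lemma transpose_diff: "transpose (A - B) = transpose A - transpose (B :: real^'n^'m)"
  by (simp add: vec_eq_iff transpose_def)

lemma matrix_diff_ldistrib: "A ** (B - C) = A ** B - A ** (C :: real^'p^'n)"
  by (simp add: matrix_matrix_mult_def vec_eq_iff right_diff_distrib sum_subtractf)

lemma matrix_diff_rdistrib: "(A - B) ** C = A ** C - B ** (C :: real^'p^'n)"
  by (simp add: matrix_matrix_mult_def vec_eq_iff left_diff_distrib sum_subtractf)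

lemma matrix_add_rdistrib: "(A + B) ** C = A ** C + B ** (C :: real^'p^'n)"
  by (simp add: matrix_matrix_mult_def vec_eq_iff distrib_right sum.distrib)

lemma inner_matrix_transpose: "x \<bullet> (A *v y) = (transpose A *v x) \<bullet> (y :: real^'n)"
  by (metis dot_lmul_matrix vector_transpose_matrix transpose_transpose)

text \<open>By symmetry, vanishing of the rows outside \<open>V\<close> forces vanishing of the
  columns, so a one-sided identity suffices.\<close>

lemma sym_mats_iff: "A \<in> sym_mats V \<longleftrightarrow> transpose A = A \<and> coord_proj V ** A = A"
proof -
  have "(\<forall>i j. i \<notin> V \<or> j \<notin> V \<longrightarrow> A $ i $ j = 0) \<longleftrightarrow> coord_proj V ** A = A" if "transpose A = A"
  proof -
    have "A $ i $ j = A $ j $ i" for i j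
      using that by (metis transpose_def vec_lambda_beta)
    then show ?thesis
      unfolding vec_eq_iff coord_proj_mult_left by metis
  qed
  then show ?thesis unfolding sym_mats_def by blast
qed

lemma sym_mats_transpose: "A \<in> sym_mats V \<Longrightarrow> transpose A = A"
  and sym_mats_proj_left: "A \<in> sym_mats V \<Longrightarrow> coord_proj V ** A = A"
  by (simp_all add: sym_mats_iff)

lemma sym_mats_proj_right: "A \<in> sym_mats V \<Longrightarrow> A ** coord_proj V = A"
  by (metis matrix_transpose_mul sym_mats_iff transpose_coord_proj)

lemma sym_mats_mono: "A \<in> sym_mats V \<Longrightarrow> V \<subseteq> W \<Longrightarrow> A \<in> sym_mats W"
  by (auto simp: sym_mats_def)

lemma sym_mats_congruence:
  assumes "transpose A = A" and "coord_proj V ** L = L"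
  shows "L ** A ** transpose L \<in> sym_mats V"
  using assms by (simp add: sym_mats_iff matrix_transpose_mul matrix_mul_assoc)

lemma supported_iff: "(\<forall>i. i \<notin> V \<longrightarrow> x $ i = 0) \<longleftrightarrow> coord_proj V *v x = x"
  by (auto simp: vec_eq_iff coord_proj_mult_vec)

lemma supported_matrix_iff:
  "coord_proj V ** Q ** coord_proj W = Q \<longleftrightarrow> (\<forall>i j. i \<notin> V \<or> j \<notin> W \<longrightarrow> Q $ i $ j = 0)"
  unfolding vec_eq_iff coord_proj_mult_left coord_proj_mult_right by metis

lemma inner_congruence:
  fixes L :: "real^'n^'m" and A :: "real^'n^'n"
  shows "x \<bullet> ((L ** A ** transpose L) *v x) = (transpose L *v x) \<bullet> (A *v (transpose L *v x))"
proof -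
  have "x \<bullet> ((L ** A ** transpose L) *v x) = x \<bullet> (L *v (A *v (transpose L *v x)))"
    by (simp only: matrix_vector_mul_assoc matrix_mul_assoc)
  then show ?thesis by (simp only: inner_matrix_transpose[of x L])
qed

text \<open>A padded matrix only sees the \<open>V\<close>-part of a vector, so nonnegativity
  extends from vectors supported on \<open>V\<close> to all vectors.\<close>

lemma pos_semidefD: 
  assumes "pos_semidef V A" shows "0 \<le> x \<bullet> (A *v x)"
proof -
  have A: "A \<in> sym_mats V" using assms by (simp add: pos_semidef_def)
  have "A = coord_proj V ** A ** transpose (coord_proj V)"
    using A by (simp add: sym_mats_proj_left sym_mats_proj_right)
  then have "x \<bullet> (A *v x) = (coord_proj V *v x) \<bullet> (A *v (coord_proj V *v x))"
    by (metis inner_congruence transpose_coord_proj)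
  also have "\<dots> \<ge> 0"
    using assms unfolding pos_semidef_def supported_iff
    by (metis matrix_vector_mul_assoc coord_proj_idem)
  finally show ?thesis .
qed

lemma pos_semidef_iff: "pos_semidef V A \<longleftrightarrow> A \<in> sym_mats V \<and> (\<forall>x. 0 \<le> x \<bullet> (A *v x))"
  using pos_semidefD by (auto simp: pos_semidef_def)

lemma pos_semidef_congruence:
  assumes "pos_semidef V A" and "coord_proj W ** L = L"
  shows "pos_semidef W (L ** A ** transpose L)"
  using assms unfolding pos_semidef_iff inner_congruence
  by (blast intro: sym_mats_congruence dest: sym_mats_transpose)

lemma pos_def_imp_pos_semidef: "pos_def V A \<Longrightarrow> pos_semidef V A"
  unfolding pos_def_def pos_semidef_def by (metis inner_zero_left order.refl order_less_imp_le)

text \<open>The principal submatrix on \<open>V\<close>, left padded with zeros so that blocks of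
  all sizes share one type.\<close>

definition block :: "'n::finite set \<Rightarrow> real^'n^'n \<Rightarrow> real^'n^'n" where
  "block V A = coord_proj V ** A ** coord_proj V"

lemma block_nth: "block V A $ i $ j = (if i \<in> V \<and> j \<in> V then A $ i $ j else 0)"
  by (simp add: block_def coord_proj_mult_left coord_proj_mult_right)

lemma block_sym_mats: "transpose A = A \<Longrightarrow> block V A \<in> sym_mats V"
  unfolding block_def using sym_mats_congruence[of A V "coord_proj V"] by simp

lemma block_id: "A \<in> sym_mats V \<Longrightarrow> block V A = A"
  by (simp add: block_def sym_mats_proj_left sym_mats_proj_right)

lemma rank_block_le: "rank (block V A) \<le> rank A"
  unfolding block_def by (meson rank_mul_le_left rank_mul_le_right order.trans)

lemma pos_semidef_block: "pos_semidef W A \<Longrightarrow> pos_semidef V (block V A)"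
  unfolding block_def using pos_semidef_congruence[of W A V "coord_proj V"] by simp

lemma pos_def_block:
  assumes "pos_def W A" and "V \<subseteq> W"
  shows "pos_def V (block V A)"
proof -
  have "0 < x \<bullet> (block V A *v x)" if x: "coord_proj V *v x = x" "x \<noteq> 0" for x
  proof -
    have "x \<bullet> (block V A *v x) = x \<bullet> (A *v x)"
      unfolding block_def using inner_congruence[of x "coord_proj V" A] x by simp
    moreover have "\<forall>i. i \<notin> W \<longrightarrow> x $ i = 0"
      using x(1) assms(2) unfolding supported_iff[symmetric] by blast
    ultimately show ?thesis using assms(1) x(2) by (simp add: pos_def_def)
  qed
  then show ?thesis
    using assms(1) by (auto simp: pos_def_def supported_iff block_sym_mats sym_mats_transpose)
qed

section \<open>Coordinate subspaces and ranks of padded matrices\<close>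

lemma dim_supported: "dim {x :: real^'n. \<forall>i. i \<notin> V \<longrightarrow> x $ i = 0} = card V"
  using dim_substandard_cart[of V, where 'a = real] by (simp add: dim_vec_eq)

lemma subspace_supported: "subspace {x :: real^'n. \<forall>i. i \<notin> V \<longrightarrow> x $ i = 0}"
  by (auto simp: subspace_def)

lemma range_coord_proj: "range ((*v) (coord_proj V)) = {x. \<forall>i. i \<notin> V \<longrightarrow> x $ i = 0}"
proof
  show "range ((*v) (coord_proj V)) \<subseteq> {x. \<forall>i. i \<notin> V \<longrightarrow> x $ i = 0}"
    by (auto simp: coord_proj_mult_vec)
  show "{x. \<forall>i. i \<notin> V \<longrightarrow> x $ i = 0} \<subseteq> range ((*v) (coord_proj V))"
    unfolding supported_iff by (metis (mono_tags, lifting) mem_Collect_eq rangeI subsetI)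
qed

lemma rank_coord_proj: "rank (coord_proj V) = card V"
  unfolding rank_dim_range range_coord_proj by (rule dim_supported)

lemma rank_le_card: "A \<in> sym_mats V \<Longrightarrow> rank A \<le> card V"
  by (metis rank_coord_proj rank_mul_le_left sym_mats_proj_left)

lemma coord_proj_rank_variety: "R \<subseteq> V \<Longrightarrow> card R \<le> r \<Longrightarrow> coord_proj R \<in> rank_variety V r"
  by (auto simp: rank_variety_def rank_coord_proj sym_mats_iff coord_proj_mult Int_absorb1)

subsection \<open>Polynomial functions and irreducibility of the rank variety\<close>

lemma polynomial_function_matrixI:
  fixes F :: "'a::real_normed_vector \<Rightarrow> real^'n^'m"
  assumes "\<And>i j. real_polynomial_function (\<lambda>x. F x $ i $ j)"
  shows "polynomial_function F"
  unfolding polynomial_function_iff_Basis_inner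
  using assms by (auto simp: Basis_vec_def inner_axis)

lemma polynomial_function_matrix_nth:
  assumes "polynomial_function F"
  shows "real_polynomial_function (\<lambda>x. (F x :: real^'n^'m) $ i $ j)"
proof -
  have "bounded_linear (\<lambda>A :: real^'n^'m. A $ i $ j)"
    by (rule bounded_linear_compose[OF bounded_linear_vec_nth bounded_linear_vec_nth])
  then show ?thesis using assms unfolding polynomial_function_def o_def by blast
qed

lemma polynomial_function_matrix_mult:
  fixes F :: "'a::real_normed_vector \<Rightarrow> real^'n^'m" and G :: "'a \<Rightarrow> real^'p^'n"
  assumes "polynomial_function F" and "polynomial_function G"
  shows "polynomial_function (\<lambda>x. F x ** G x)"
proof (rule polynomial_function_matrixI)
  show "real_polynomial_function (\<lambda>x. (F x ** G x) $ i $ j)" for i j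
    unfolding matrix_matrix_mult_def
    by (simp, intro real_polynomial_function_sum real_polynomial_function.intros(4)
        polynomial_function_matrix_nth assms) simp
qed

lemma polynomial_function_transpose:
  fixes F :: "'a::real_normed_vector \<Rightarrow> real^'n^'m"
  assumes "polynomial_function F"
  shows "polynomial_function (\<lambda>x. transpose (F x))"
  by (rule polynomial_function_matrixI) (simp add: transpose_def polynomial_function_matrix_nth assms)

lemma real_polynomial_function_det:
  fixes F :: "'a::real_normed_vector \<Rightarrow> real^'n^'n"
  assumes "polynomial_function F"
  shows "real_polynomial_function (\<lambda>x. det (F x))"
  unfolding det_def
  by (intro real_polynomial_function_sum real_polynomial_function.intros(4) real_polynomial_function_prod
      real_polynomial_function.intros(2) polynomial_function_matrix_nth assms) (simp_all add: finite_permutations)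

lemma real_polynomial_function_comp:
  "real_polynomial_function g \<Longrightarrow> polynomial_function f \<Longrightarrow> real_polynomial_function (\<lambda>x. g (f x))"
  using real_polynomial_function_compose[of f g] by (simp add: o_def)

lemma finite_roots_real_polynomial_function:
  fixes f :: "real \<Rightarrow> real"
  assumes "real_polynomial_function f" and "f a \<noteq> 0"
  shows "finite {t. f t = 0}"
proof -
  obtain c n where f: "f = (\<lambda>x. \<Sum>i\<le>n. c i * x ^ i)"
    using assms(1) real_polynomial_function_iff_sum by blast
  have "\<exists>i\<le>n. c i \<noteq> 0"
    using assms(2) unfolding f by (metis (mono_tags, lifting) atMost_iff mult_zero_left sum.neutral)
  then show ?thesis
    unfolding f polyfun_finite_roots by simp
qed

text \<open>The range of \<open>A\<close> has dimension at most \<open>card R\<close>, so it embeds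
  by some \<open>f\<close> into the coordinate space of \<open>R\<close>, which merely labels the
  columns of \<open>Q\<close>. A left inverse \<open>g\<close> of \<open>f\<close> gives
  \<open>Q F A = A\<close>; transposing gives \<open>A F^T Q^T = A\<close>, and together
  \<open>A = Q (F A F^T) Q^T\<close>.\<close>

lemma rank_variety_factorization:
  fixes V R :: "'n::finite set"
  assumes A: "A \<in> rank_variety V (card R)"
  obtains Q S :: "real^'n^'n" where "coord_proj V ** Q ** coord_proj R = Q" and "transpose S = S"
    and "A = Q ** S ** transpose Q"
proof -
  have sym: "A \<in> sym_mats V" and rk: "rank A \<le> card R"
    using A by (auto simp: rank_variety_def)
  have sA: "subspace (range ((*v) A))"
    by (simp add: linear_subspace_image)
  have "dim (range ((*v) A)) \<le> dim {x :: real^'n. \<forall>i. i \<notin> R \<longrightarrow> x $ i = 0}"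
    using rk by (simp add: rank_dim_range dim_supported)
  then obtain f where f: "linear f" "f \<in> range ((*v) A) \<rightarrow> {x :: real^'n. \<forall>i. i \<notin> R \<longrightarrow> x $ i = 0}"
    "\<And>x. x \<in> range ((*v) A) \<Longrightarrow> norm (f x) = norm x"
    using isometry_subset_subspace[OF sA subspace_supported] by blast
  have "inj_on f (range ((*v) A))"
  proof (rule inj_onI)
    fix x y assume xy: "x \<in> range ((*v) A)" "y \<in> range ((*v) A)" "f x = f y"
    then have "x - y \<in> range ((*v) A)" by (simp add: sA subspace_diff)
    then have "norm (x - y) = norm (f x - f y)" using f(1,3) by (metis linear_diff)
    then show "x = y" using xy(3) by simp
  qed
  then obtain g where g: "linear g" "\<And>x. x \<in> range ((*v) A) \<Longrightarrow> g (f x) = x"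
    using linear_exists_left_inverse_on[OF f(1) sA] by metis
  define F where "F = matrix f"
  define Q where "Q = coord_proj V ** matrix g ** coord_proj R"
  have 1: "Q ** F ** A = A"
  proof -
    have "(Q ** F ** A) *v x = A *v x" for x
    proof -
      have "coord_proj R *v f (A *v x) = f (A *v x)"
        unfolding supported_iff[symmetric] using f(2) by auto
      then have "(Q ** F ** A) *v x = coord_proj V *v (A *v x)"
        by (simp add: Q_def F_def matrix_vector_mul_assoc[symmetric] matrix_works f(1) g)
      then show ?thesis by (simp add: matrix_vector_mul_assoc sym_mats_proj_left[OF sym])
    qed
    then show ?thesis by (simp add: matrix_eq)
  qed
  have 2: "A ** (transpose F ** transpose Q) = A"
    using arg_cong[OF 1, of transpose] by (simp add: matrix_transpose_mul sym_mats_transpose[OF sym])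
  show ?thesis
  proof (rule that[of Q "F ** A ** transpose F"])
    show "coord_proj V ** Q ** coord_proj R = Q"
      by (simp add: Q_def matrix_mul_assoc) (simp add: matrix_mul_assoc[symmetric])
    show "transpose (F ** A ** transpose F) = F ** A ** transpose F"
      by (simp add: matrix_transpose_mul sym_mats_transpose[OF sym] matrix_mul_assoc)
    have "Q ** (F ** A ** transpose F) ** transpose Q = Q ** F ** A ** (transpose F ** transpose Q)"
      by (simp add: matrix_mul_assoc)
    then show "A = Q ** (F ** A ** transpose F) ** transpose Q"
      using 1 2 by simp
  qed
qed

lemma rank_variety_factorized:
  assumes "coord_proj V ** Q ** coord_proj R = Q" and "transpose S = S"
  shows "Q ** S ** transpose Q \<in> rank_variety V (card R)"
proof -
  have "rank (Q ** S ** transpose Q) \<le> rank Q"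
    by (metis matrix_mul_assoc rank_mul_le_left)
  also have "\<dots> \<le> card R"
    using rank_mul_le_right[of "coord_proj V ** Q" "coord_proj R"] assms(1)
    by (simp add: rank_coord_proj)
  finally have "rank (Q ** S ** transpose Q) \<le> card R" .
  moreover have "coord_proj V ** Q = Q"
    by (metis assms(1) coord_proj_idem matrix_mul_assoc)
  ultimately show ?thesis
    using sym_mats_congruence[OF assms(2)] by (simp add: rank_variety_def)
qed

text \<open>The parameters \<open>(Q, S)\<close> form a linear space although the variety does not.
  Joining the parameters of \<open>A\<close> and \<open>B\<close> by a line gives a polynomial curve
  in the variety; \<open>f\<close> and \<open>g\<close> restrict to nonzero univariate polynomials
  on it, so some point avoids all of their roots.\<close>

lemma rank_variety_irreducible:
  fixes V :: "'n::finite set"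
  assumes r: "r \<le> CARD('n)"
    and f: "real_polynomial_function f" "A \<in> rank_variety V r" "f A \<noteq> 0"
    and g: "real_polynomial_function g" "B \<in> rank_variety V r" "g B \<noteq> 0"
  obtains C where "C \<in> rank_variety V r" "f C \<noteq> 0" "g C \<noteq> 0"
proof -
  obtain R :: "'n set" where R: "card R = r"
    using r obtain_subset_with_card_n by metis
  obtain Q S where Q: "coord_proj V ** Q ** coord_proj R = Q" "transpose S = S"
    "A = Q ** S ** transpose Q"
    using rank_variety_factorization f(2) R by metis
  obtain Q' S' where Q': "coord_proj V ** Q' ** coord_proj R = Q'" "transpose S' = S'"
    "B = Q' ** S' ** transpose Q'"
    using rank_variety_factorization g(2) R by metis
  define q where "q t = Q + t *\<^sub>R (Q' - Q)" for t :: real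
  define s where "s t = S + t *\<^sub>R (S' - S)" for t :: real
  define c where "c t = q t ** s t ** transpose (q t)" for t
  have "coord_proj V ** q t ** coord_proj R = q t" for t
    using Q(1) Q'(1) unfolding supported_matrix_iff by (simp add: q_def)
  moreover have "transpose (s t) = s t" for t
    using Q(2) Q'(2) by (simp add: s_def vec_eq_iff transpose_def)
  ultimately have c: "c t \<in> rank_variety V r" for t
    using rank_variety_factorized R unfolding c_def by blast
  have "polynomial_function q" "polynomial_function s"
    unfolding q_def s_def by (auto intro!: polynomial_function_add polynomial_function_mult)
  then have pc: "polynomial_function c"
    unfolding c_def by (intro polynomial_function_matrix_mult polynomial_function_transpose)
  have "f (c 0) \<noteq> 0" "g (c 1) \<noteq> 0"
    using f g by (simp_all add: c_def q_def s_def Q(3) Q'(3))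
  then have "finite ({t. f (c t) = 0} \<union> {t. g (c t) = 0})"
    using finite_roots_real_polynomial_function[of "\<lambda>t. f (c t)"] 
      finite_roots_real_polynomial_function[of "\<lambda>t. g (c t)"]
      real_polynomial_function_comp[OF f(1) pc] real_polynomial_function_comp[OF g(1) pc] by blast
  then obtain t where "f (c t) \<noteq> 0" "g (c t) \<noteq> 0"
    using ex_new_if_finite[OF infinite_UNIV_char_0] by blast
  then show ?thesis using that c by blast
qed

section \<open>Inequalities and null vectors of positive semidefinite forms\<close>

lemma pos_semidef_Cauchy_Schwarz:
  assumes "pos_semidef V A" and "0 < x \<bullet> (A *v x)"
  shows "(y \<bullet> (A *v x))\<^sup>2 \<le> (x \<bullet> (A *v x)) * (y \<bullet> (A *v y))"
proof -
  define q where "q = x \<bullet> (A *v x)"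
  define b where "b = y \<bullet> (A *v x)"
  have tA: "transpose A = A" using assms(1) by (simp add: pos_semidef_iff sym_mats_iff)
  have b': "x \<bullet> (A *v y) = b"
    by (metis b_def inner_commute inner_matrix_transpose tA)
  \<comment> \<open>Up to scaling by \<open>q\<close>, this is the component of \<open>y\<close>
    orthogonal to \<open>x\<close> for the form; its nonnegativity is \<open>q\<close> times the
    claim.\<close>
  have "0 \<le> (q *\<^sub>R y - b *\<^sub>R x) \<bullet> (A *v (q *\<^sub>R y - b *\<^sub>R x))"
    using assms(1) by (rule pos_semidefD)
  also have "\<dots> = q * (q * (y \<bullet> (A *v y)) - b\<^sup>2)"
    using b' by (simp add: matrix_vector_mult_diff_distrib matrix_vector_mult_scaleR inner_diff_left
        inner_diff_right power2_eq_square algebra_simps flip: q_def b_def)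
  finally show ?thesis
    using assms(2) by (simp add: zero_le_mult_iff flip: q_def b_def)
qed

text \<open>If \<open>A x\<close> were nonzero, moving from \<open>x\<close> a little against the
  direction \<open>A x\<close> would make the form negative.\<close>

lemma pos_semidef_null:
  assumes "pos_semidef V A" and "x \<bullet> (A *v x) = 0"
  shows "A *v x = 0"
proof (rule ccontr)
  assume nz: "A *v x \<noteq> 0"
  define y where "y = A *v x"
  define c where "c = y \<bullet> (A *v y)"
  define n where "n = y \<bullet> y"
  \<comment> \<open>Small enough that \<open>e * c \<le> n\<close>, so the linear term dominates;
    the \<open>+ 1\<close> keeps the denominator positive when \<open>c = 0\<close>.\<close>
  define e where "e = n / (c + 1)"
  have c: "c \<ge> 0" unfolding c_def using assms(1) by (rule pos_semidefD)
  have n: "n > 0" using nz by (simp add: n_def y_def)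
  have tA: "transpose A = A" using assms(1) by (simp add: pos_semidef_iff sym_mats_iff)
  have xy: "x \<bullet> (A *v y) = n"
    by (metis n_def y_def inner_matrix_transpose tA)
  have "0 \<le> (x - e *\<^sub>R y) \<bullet> (A *v (x - e *\<^sub>R y))"
    using assms(1) by (rule pos_semidefD)
  also have "\<dots> = e * (e * c - 2 * n)"
    using assms(2) xy by (simp add: matrix_vector_mult_diff_distrib matrix_vector_mult_scaleR
        inner_diff_left inner_diff_right algebra_simps flip: y_def n_def c_def)
  finally have "0 \<le> e * (e * c - 2 * n)" .
  moreover have "e > 0" using c n by (simp add: e_def)
  moreover have "e * c \<le> n" using c n by (simp add: e_def field_simps)
  ultimately show False using n by (simp add: zero_le_mult_iff)
qed

subsection \<open>Principal minors\<close>

text \<open>The identity on the complement of \<open>R\<close> makes this full-size determinant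
  equal to the principal minor on \<open>R\<close>.\<close>

definition minor :: "'n::finite set \<Rightarrow> real^'n^'n \<Rightarrow> real" where
  "minor R A = det (block R A + coord_proj (- R))"

lemma real_polynomial_function_minor: "real_polynomial_function (minor R)"
proof -
  have "polynomial_function (\<lambda>A. block R A + coord_proj (- R))"
    unfolding block_def
    by (intro polynomial_function_add polynomial_function_matrix_mult polynomial_function_const
        polynomial_function_id)
  then show ?thesis unfolding minor_def by (rule real_polynomial_function_det)
qed

lemma minor_coord_proj: "minor R (coord_proj R) = 1"
proof -
  have "block R (coord_proj R) + coord_proj (- R) = mat 1"
    by (auto simp: vec_eq_iff block_nth coord_proj_nth mat_def)
  then show ?thesis by (simp add: minor_def)
qed

lemma minor_nonzero_left_inverse:
  assumes "minor R A \<noteq> 0"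
  obtains J where "J ** block R A = coord_proj R"
proof -
  obtain J where J: "J ** (block R A + coord_proj (- R)) = mat 1"
    using assms unfolding minor_def invertible_det_nz[symmetric] invertible_left_inverse by blast
  have "(block R A + coord_proj (- R)) ** coord_proj R = block R A"
    by (simp add: vec_eq_iff coord_proj_mult_right block_nth coord_proj_nth)
  then have "J ** block R A = J ** (block R A + coord_proj (- R)) ** coord_proj R"
    by (simp add: matrix_mul_assoc[symmetric])
  then show ?thesis using that J by simp
qed

text \<open>Turns a polynomial inequality into a lower rank bound: \<open>coord_proj R\<close>
  factors through \<open>block R A\<close>, which is itself a block of
  \<open>block V A\<close>.\<close>

lemma minor_nonzero_rank:
  assumes "minor R A \<noteq> 0" and "R \<subseteq> V"
  shows "card R \<le> rank (block V A)"
proof -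
  obtain J where "J ** block R A = coord_proj R"
    using assms minor_nonzero_left_inverse by blast
  then have "card R \<le> rank (block R A)"
    by (metis rank_coord_proj rank_mul_le_right)
  also have "block R A = block R (block V A)"
    using assms(2) by (auto simp: vec_eq_iff block_nth)
  then have "rank (block R A) \<le> rank (block V A)"
    by (simp add: rank_block_le)
  finally show ?thesis .
qed

text \<open>A null vector of a semidefinite form lies in its kernel, and a nonzero minor excludes
  kernel vectors supported on \<open>V\<close>.\<close>

lemma minor_nonzero_pos_def:
  assumes "minor V A \<noteq> 0" and "pos_semidef W A"
  shows "pos_def V (block V A)"
proof -
  obtain J where J: "J ** block V A = coord_proj V"
    using assms minor_nonzero_left_inverse by blast
  have psd: "pos_semidef V (block V A)" using assms(2) by (rule pos_semidef_block)
  have "0 < x \<bullet> (block V A *v x)" if x: "coord_proj V *v x = x" "x \<noteq> 0" for x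
  proof (rule ccontr)
    assume "\<not> ?thesis"
    with pos_semidefD[OF psd] have "x \<bullet> (block V A *v x) = 0" by (simp add: antisym not_less)
    then have "block V A *v x = 0" using pos_semidef_null[OF psd] by blast
    then have "coord_proj V *v x = 0"
      by (metis J matrix_vector_mul_assoc matrix_vector_mult_0_right)
    then show False using x by simp
  qed
  then show ?thesis using psd by (simp add: pos_def_def pos_semidef_def supported_iff)
qed

subsection \<open>Gluing positive definite matrices\<close>

text \<open>\<open>K\<close> is the projection onto the coordinates in \<open>C\<close> that is orthogonal for the form \<open>P\<close>.\<close>

lemma schur_projection:
  assumes P: "pos_def V P" and C: "C \<subseteq> V"
  obtains K where "coord_proj C ** K = K" and "K ** coord_proj V = K"
    and "K ** coord_proj C = coord_proj C" and "coord_proj C ** P ** K = coord_proj C ** P"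
proof -
  have PV: "P \<in> sym_mats V" using P by (simp add: pos_def_def)
  define N where "N = block C P"
  \<comment> \<open>The identity outside \<open>C\<close> makes the definite block \<open>N\<close>
    invertible as a full-size matrix.\<close>
  define M where "M = N + coord_proj (- C)"
  have N: "pos_def C N" unfolding N_def using P C by (rule pos_def_block)
  have NC: "N \<in> sym_mats C" using N by (simp add: pos_def_def)
  have CM: "coord_proj C ** M = N" and MC: "M ** coord_proj C = N"
    and M': "coord_proj (- C) ** M = coord_proj (- C)"
    by (auto simp: M_def N_def vec_eq_iff coord_proj_mult_left coord_proj_mult_right block_nth coord_proj_nth)
  have "x = 0" if "M *v x = 0" for x
  proof -
    have "N *v x = 0" using that by (simp flip: CM matrix_vector_mul_assoc)
    then have "N *v (coord_proj C *v x) = 0"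
      by (simp add: matrix_vector_mul_assoc sym_mats_proj_right[OF NC])
    then have 1: "coord_proj C *v x = 0"
      using N unfolding pos_def_def supported_iff
      by (metis coord_proj_idem inner_zero_right less_irrefl matrix_vector_mul_assoc)
    have 2: "coord_proj (- C) *v x = 0"
      using that by (metis M' matrix_vector_mul_assoc matrix_vector_mult_0_right)
    show "x = 0"
      using 1 2 unfolding vec_eq_iff coord_proj_mult_vec by (metis ComplI zero_index)
  qed
  then obtain J where J: "J ** M = mat 1"
    using matrix_left_invertible_ker by blast
  then have J': "M ** J = mat 1" using matrix_left_right_inverse by blast
  have "J ** coord_proj C = J ** (coord_proj C ** M) ** J"
    by (metis J' matrix_mul_assoc matrix_mul_rid)
  also have "\<dots> = coord_proj C ** J"
    by (metis CM MC J matrix_mul_assoc matrix_mul_lid)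
  finally have JC: "J ** coord_proj C = coord_proj C ** J" .
  \<comment> \<open>In block form the \<open>C\<close>-rows of \<open>K\<close> are
    \<open>N^-1\<close> times the \<open>C\<close>-rows of \<open>P\<close>, hence the identity on
    the columns in \<open>C\<close>; all other rows vanish.\<close>
  define K where "K = J ** coord_proj C ** P"
  show ?thesis
  proof (rule that[of K])
    show "coord_proj C ** K = K"
      unfolding K_def JC by (simp add: matrix_mul_assoc)
    show "K ** coord_proj V = K"
      unfolding K_def by (simp add: sym_mats_proj_right[OF PV] flip: matrix_mul_assoc)
    have "K ** coord_proj C = J ** N"
      unfolding K_def N_def block_def by (simp add: matrix_mul_assoc)
    also have "\<dots> = coord_proj C" by (metis MC J matrix_mul_assoc matrix_mul_lid)
    finally show "K ** coord_proj C = coord_proj C" .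
    have "coord_proj C ** P ** K = N ** J ** P"
      unfolding K_def JC N_def block_def by (simp add: matrix_mul_assoc)
    also have "\<dots> = coord_proj C ** P"
      by (metis CM J' matrix_mul_assoc matrix_mul_rid)
    finally show "coord_proj C ** P ** K = coord_proj C ** P" .
  qed
qed

text \<open>Completing the square: the hypotheses give \<open>K^T P K = K^T P = P K\<close>, so the
  mixed terms between \<open>K\<close> and \<open>coord_proj V - K\<close> cancel.\<close>

lemma schur_decomposition:
  assumes P: "P \<in> sym_mats V" and K: "coord_proj C ** K = K" "coord_proj C ** P ** K = coord_proj C ** P"
  shows "P = transpose K ** P ** K + transpose (coord_proj V - K) ** P ** (coord_proj V - K)"
proof -
  have tK: "transpose K ** coord_proj C = transpose K"
    by (metis K(1) matrix_transpose_mul transpose_coord_proj)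
  have 1: "transpose K ** P ** K = transpose K ** P"
    by (metis K(2) tK matrix_mul_assoc)
  have "P ** K = transpose K ** P ** K"
    using arg_cong[OF 1, of transpose]
    by (simp add: matrix_transpose_mul sym_mats_transpose[OF P] matrix_mul_assoc)
  then have 2: "P ** K = transpose K ** P" using 1 by simp
  have 3: "transpose K ** P ** coord_proj V = transpose K ** P"
    by (simp add: sym_mats_proj_right[OF P] flip: matrix_mul_assoc)
  show ?thesis
    by (simp add: transpose_diff matrix_diff_ldistrib matrix_diff_rdistrib 1 2 3
        sym_mats_proj_left[OF P] sym_mats_proj_right[OF P])
qed

text \<open>Each form splits into a part passing through the coordinates in \<open>C\<close> and a
  residual. The parts through \<open>C\<close> use only the common block, so a single such part
  together with both residuals extends both forms.\<close>

lemma pos_def_glue: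
  fixes V\<^sub>1 V\<^sub>2 :: "'n::finite set"
  assumes P1: "pos_def V\<^sub>1 P\<^sub>1" and P2: "pos_def V\<^sub>2 P\<^sub>2"
    and eq: "block (V\<^sub>1 \<inter> V\<^sub>2) P\<^sub>1 = block (V\<^sub>1 \<inter> V\<^sub>2) P\<^sub>2"
  obtains P :: "real^'n^'n" where "pos_def (V\<^sub>1 \<union> V\<^sub>2) P" and "block V\<^sub>1 P = P\<^sub>1" and "block V\<^sub>2 P = P\<^sub>2"
proof -
  define C where "C = V\<^sub>1 \<inter> V\<^sub>2"
  define c where "c = coord_proj C"
  define p where "p = coord_proj V\<^sub>1"
  define q where "q = coord_proj V\<^sub>2"
  have C12: "C \<subseteq> V\<^sub>1" "C \<subseteq> V\<^sub>2" by (auto simp: C_def)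
  have sym: "P\<^sub>1 \<in> sym_mats V\<^sub>1" "P\<^sub>2 \<in> sym_mats V\<^sub>2" using P1 P2 by (auto simp: pos_def_def)
  have pq: "p ** q = c" "q ** p = c" "p ** c = c" "q ** c = c" "c ** p = c" "c ** q = c" "p ** p = p"
    "q ** q = q" "c ** c = c"
    unfolding p_def q_def c_def C_def coord_proj_mult by (simp_all add: Int_ac)
  have tr: "transpose p = p" "transpose q = q" "transpose c = c" by (simp_all add: p_def q_def c_def)
  obtain K where K: "c ** K = K" "K ** p = K" "K ** c = c" "c ** P\<^sub>1 ** K = c ** P\<^sub>1"
    using schur_projection[OF P1 C12(1)] unfolding c_def p_def by blast
  obtain L where L: "c ** L = L" "L ** q = L" "L ** c = c" "c ** P\<^sub>2 ** L = c ** P\<^sub>2"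
    using schur_projection[OF P2 C12(2)] unfolding c_def q_def by blast
  \<comment> \<open>The glued form makes the residuals \<open>D\<close> and \<open>F\<close> orthogonal to each other and to the clique part \<open>H\<close>.\<close>
  define H where "H = K + L - c"
  define D where "D = p - K"
  define F where "F = q - L"
  have dec1: "P\<^sub>1 = transpose K ** P\<^sub>1 ** K + transpose D ** P\<^sub>1 ** D"
    unfolding D_def p_def using schur_decomposition sym(1) K unfolding c_def by blast
  have dec2: "P\<^sub>2 = transpose L ** P\<^sub>2 ** L + transpose F ** P\<^sub>2 ** F"
    unfolding F_def q_def using schur_decomposition sym(2) L unfolding c_def by blast
  \<comment> \<open>Only the coordinates in \<open>C\<close> are shared by both vertex sets, and
    \<open>L\<close> and \<open>K\<close> are the identity there. Subtracting \<open>c\<close> in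
    \<open>H\<close> therefore makes \<open>H\<close> restrict to \<open>K\<close> on the first set
    and to \<open>L\<close> on the second.\<close>
  have Lp: "L ** p = c" by (metis L(2,3) pq(2) matrix_mul_assoc)
  have Kq: "K ** q = c" by (metis K(2,3) pq(1) matrix_mul_assoc)
  have Hp: "H ** p = K" and Hq: "H ** q = L" and Hc: "H ** c = c"
    and Dp: "D ** p = D" and Dq: "D ** q = 0" and Fp: "F ** p = 0" and Fq: "F ** q = F"
    by (simp_all add: H_def D_def F_def matrix_diff_rdistrib matrix_add_rdistrib K L Kq Lp pq)
  have cH: "c ** H = H" and pD: "p ** D = D" and qF: "q ** F = F"
  proof -
    show "c ** H = H"
      by (simp add: H_def matrix_diff_ldistrib matrix_add_ldistrib K L pq)
    have "p ** K = K" by (metis K(1) pq(3) matrix_mul_assoc)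
    then show "p ** D = D" by (simp add: D_def matrix_diff_ldistrib pq)
    have "q ** L = L" by (metis L(1) pq(4) matrix_mul_assoc)
    then show "q ** F = F" by (simp add: F_def matrix_diff_ldistrib pq)
  qed
  define P where "P = transpose H ** P\<^sub>1 ** H + transpose D ** P\<^sub>1 ** D + transpose F ** P\<^sub>2 ** F"
  have congr: "x ** (transpose A ** B ** A) ** x = transpose (A ** x) ** B ** (A ** x)"
    if "transpose x = x" for x A B :: "real^'n^'n"
    using that by (simp add: matrix_transpose_mul matrix_mul_assoc)
  have b1: "block V\<^sub>1 P = P\<^sub>1"
    unfolding block_def P_def p_def[symmetric]
    by (simp only: matrix_add_ldistrib matrix_add_rdistrib congr[OF tr(1)] Hp Dp Fp)
      (simp add: dec1[symmetric])
  \<comment> \<open>The second block of \<open>P\<close> involves \<open>P\<^sub>1\<close> where the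
    decomposition of \<open>P\<^sub>2\<close> involves \<open>P\<^sub>2\<close>; since
    \<open>L\<close> maps into \<open>C\<close>, where the two agree, this makes no
    difference.\<close>
  have "transpose L ** P\<^sub>1 ** L = transpose (c ** L) ** P\<^sub>1 ** (c ** L)" by (simp add: L)
  also have "\<dots> = transpose L ** (c ** P\<^sub>1 ** c) ** L"
    by (simp add: matrix_transpose_mul tr matrix_mul_assoc)
  also have "\<dots> = transpose L ** (c ** P\<^sub>2 ** c) ** L"
    using eq unfolding block_def c_def C_def by simp
  also have "\<dots> = transpose (c ** L) ** P\<^sub>2 ** (c ** L)"
    by (simp add: matrix_transpose_mul tr matrix_mul_assoc)
  also have "\<dots> = transpose L ** P\<^sub>2 ** L" by (simp add: L)
  finally have LP: "transpose L ** P\<^sub>1 ** L = transpose L ** P\<^sub>2 ** L" .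
  have b2: "block V\<^sub>2 P = P\<^sub>2"
    unfolding block_def P_def q_def[symmetric]
    by (simp only: matrix_add_ldistrib matrix_add_rdistrib congr[OF tr(2)] Hq Dq Fq)
      (simp add: dec2[symmetric] LP)
  define u where "u = coord_proj (V\<^sub>1 \<union> V\<^sub>2)"
  have up: "p ** u = p" "q ** u = q" "c ** u = c"
    unfolding u_def p_def q_def c_def C_def coord_proj_mult by (auto intro!: arg_cong[of _ _ coord_proj])
  have Hu: "H ** u = H" and Du: "D ** u = D" and Fu: "F ** u = F"
  proof -
    have "K ** u = K" by (metis K(2) up(1) matrix_mul_assoc)
    moreover have "L ** u = L" by (metis L(2) up(2) matrix_mul_assoc)
    ultimately show "H ** u = H" "D ** u = D" "F ** u = F"
      by (simp_all add: H_def D_def F_def matrix_diff_rdistrib matrix_add_rdistrib up)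
  qed
  have tP: "transpose P\<^sub>1 = P\<^sub>1" "transpose P\<^sub>2 = P\<^sub>2" using sym by (auto simp: sym_mats_iff)
  have "u ** transpose A = transpose A" if "A ** u = A" for A :: "real^'n^'n"
    using that by (metis matrix_transpose_mul transpose_coord_proj u_def)
  then have "P \<in> sym_mats (V\<^sub>1 \<union> V\<^sub>2)"
    unfolding sym_mats_iff P_def u_def[symmetric] using Hu Du Fu
    by (simp add: transpose_add matrix_transpose_mul tP matrix_mul_assoc matrix_add_ldistrib)
  moreover have "0 < x \<bullet> (P *v x)" if x: "u *v x = x" "x \<noteq> 0" for x
  proof -
    have nonneg: "0 \<le> y \<bullet> (P\<^sub>1 *v y)" "0 \<le> y \<bullet> (P\<^sub>2 *v y)" for y
      using P1 P2 pos_def_imp_pos_semidef pos_semidefD by blast+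
    have xP: "x \<bullet> (P *v x) = (H *v x) \<bullet> (P\<^sub>1 *v (H *v x)) + (D *v x) \<bullet> (P\<^sub>1 *v (D *v x))
        + (F *v x) \<bullet> (P\<^sub>2 *v (F *v x))"
      using inner_congruence[of x "transpose H" P\<^sub>1] inner_congruence[of x "transpose D" P\<^sub>1]
        inner_congruence[of x "transpose F" P\<^sub>2]
      by (simp add: P_def matrix_vector_mult_add_rdistrib inner_add_right)
    have pos1: "0 < y \<bullet> (P\<^sub>1 *v y)" if "p *v y = y" "y \<noteq> 0" for y
      using P1 that unfolding pos_def_def supported_iff p_def by blast
    have pos2: "0 < y \<bullet> (P\<^sub>2 *v y)" if "q *v y = y" "y \<noteq> 0" for y
      using P2 that unfolding pos_def_def supported_iff q_def by blast
    have inp: "p *v (H *v x) = H *v x" "p *v (D *v x) = D *v x" "q *v (F *v x) = F *v x"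
      using cH pq(3) pD qF by (metis matrix_vector_mul_assoc matrix_mul_assoc)+
    \<comment> \<open>If both residuals vanish, \<open>p *v x\<close> and \<open>q *v x\<close> are
      supported on \<open>C\<close>, hence so is \<open>x\<close>; there \<open>H\<close> is the
      identity, so \<open>H *v x\<close> cannot vanish too.\<close>
    have "H *v x \<noteq> 0 \<or> D *v x \<noteq> 0 \<or> F *v x \<noteq> 0"
    proof (rule ccontr)
      assume "\<not> ?thesis"
      then have 0: "H *v x = 0" "D *v x = 0" "F *v x = 0" by auto
      have "p *v x = c *v (K *v x)" "q *v x = c *v (L *v x)"
        using 0(2,3) K(1) L(1)
        by (simp_all add: D_def F_def matrix_vector_mult_diff_rdistrib matrix_vector_mul_assoc)
      then have "\<forall>i. i \<notin> C \<longrightarrow> (p *v x) $ i = 0 \<and> (q *v x) $ i = 0"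
        by (simp add: c_def coord_proj_mult_vec)
      then have "\<forall>i. i \<notin> C \<longrightarrow> x $ i = 0"
        using x(1) unfolding p_def q_def u_def vec_eq_iff coord_proj_mult_vec by (metis UnE)
      then have cx: "c *v x = x" unfolding supported_iff c_def .
      then have "H *v x = x" using Hc by (metis matrix_vector_mul_assoc)
      then show False using 0 x by simp
    qed
    then show ?thesis
      using nonneg(1)[of "H *v x"] nonneg(1)[of "D *v x"] nonneg(2)[of "F *v x"]
        pos1[OF inp(1)] pos1[OF inp(2)] pos2[OF inp(3)] unfolding xP by linarith
  qed
  ultimately have "pos_def (V\<^sub>1 \<union> V\<^sub>2) P"
    unfolding pos_def_def supported_iff u_def by blast
  then show ?thesis using that b1 b2 by blast
qed

subsection \<open>Completable matrices\<close>

definition completable :: "'n::finite set \<Rightarrow> 'n set set \<Rightarrow> real^'n^'n \<Rightarrow> bool" where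
  "completable V E A \<longleftrightarrow> (\<exists>P. pos_def V P \<and> graph_proj V E A = graph_proj V E P)"

lemma graph_proj_eq_iff:
  assumes E: "simple_graph V E" and A: "A \<in> sym_mats W" and B: "B \<in> sym_mats W'"
  shows "graph_proj V E A = graph_proj V E B \<longleftrightarrow>
    (\<forall>i\<in>V. A $ i $ i = B $ i $ i) \<and> (\<forall>i j. {i, j} \<in> E \<longrightarrow> A $ i $ j = B $ i $ j)"
proof -
  have "graph_proj V E A = graph_proj V E B \<longleftrightarrow>
      (\<forall>i\<in>V. A $ i $ i = B $ i $ i) \<and> (\<forall>e\<in>E. edge_entry A e = edge_entry B e)"
    unfolding graph_proj_def prod.inject
    by (metis (mono_tags, lifting) restrict_apply' restrict_ext)
  moreover have "(\<forall>e\<in>E. edge_entry A e = edge_entry B e) \<longleftrightarrow> (\<forall>i j. {i, j} \<in> E \<longrightarrow> A $ i $ j = B $ i $ j)"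
  proof
    assume "\<forall>e\<in>E. edge_entry A e = edge_entry B e"
    then show "\<forall>i j. {i, j} \<in> E \<longrightarrow> A $ i $ j = B $ i $ j"
      by (metis edge_entry_eq[OF A] edge_entry_eq[OF B])
  next
    assume ij: "\<forall>i j. {i, j} \<in> E \<longrightarrow> A $ i $ j = B $ i $ j"
    show "\<forall>e\<in>E. edge_entry A e = edge_entry B e"
    proof
      fix e assume e: "e \<in> E"
      then obtain i j where "e = {i, j}" using E unfolding simple_graph_def by (metis card_2_iff)
      then show "edge_entry A e = edge_entry B e"
        using e ij edge_entry_eq[OF A] edge_entry_eq[OF B] by simp
    qed
  qed
  ultimately show ?thesis by simp
qed

lemma completable_iff:
  assumes "simple_graph V E" and "A \<in> sym_mats W"
  shows "completable V E A \<longleftrightarrow> (\<exists>P. pos_def V P \<and>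
    (\<forall>i\<in>V. A $ i $ i = P $ i $ i) \<and> (\<forall>i j. {i, j} \<in> E \<longrightarrow> A $ i $ j = P $ i $ j))"
  unfolding completable_def using graph_proj_eq_iff[OF assms] by (metis pos_def_def)

lemma simple_graph_edge: "simple_graph V E \<Longrightarrow> {i, j} \<in> E \<Longrightarrow> i \<in> V \<and> j \<in> V"
  by (auto simp: simple_graph_def)

text \<open>A completion restricts to its principal block on \<open>V'\<close>, which stays positive
  definite.\<close>

lemma completable_subgraph:
  assumes g: "simple_graph V E" "simple_graph V' E'" "V' \<subseteq> V" "E' \<subseteq> E"
    and A: "A \<in> sym_mats V" "completable V E A"
  shows "completable V' E' (block V' A)"
proof -
  obtain P where P: "pos_def V P" "\<forall>i\<in>V. A $ i $ i = P $ i $ i" "\<forall>i j. {i, j} \<in> E \<longrightarrow> A $ i $ j = P $ i $ j"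
    using A completable_iff[OF g(1)] by blast
  have "pos_def V' (block V' P)" using P(1) g(3) by (rule pos_def_block)
  then show ?thesis
    unfolding completable_iff[OF g(2) block_sym_mats[OF sym_mats_transpose[OF A(1)]]]
    using P g by (intro exI[of _ "block V' P"]) (auto simp: block_nth)
qed

text \<open>Every pair in the intersection is an edge on both sides, so both completions agree with
  \<open>A\<close> on that whole block and can be glued. Each edge of the sum lies on one side, so
  the glued matrix satisfies every constraint.\<close>

lemma completable_clique_sum:
  assumes g: "simple_graph V\<^sub>1 E\<^sub>1" "simple_graph V\<^sub>2 E\<^sub>2"
    and cl: "induces_clique E\<^sub>1 (V\<^sub>1 \<inter> V\<^sub>2)" "induces_clique E\<^sub>2 (V\<^sub>1 \<inter> V\<^sub>2)"
    and A: "A \<in> sym_mats (V\<^sub>1 \<union> V\<^sub>2)"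
    and c: "completable V\<^sub>1 E\<^sub>1 (block V\<^sub>1 A)" "completable V\<^sub>2 E\<^sub>2 (block V\<^sub>2 A)"
  shows "completable (V\<^sub>1 \<union> V\<^sub>2) (E\<^sub>1 \<union> E\<^sub>2) A"
proof -
  have bs: "block V A \<in> sym_mats V" for V
    by (rule block_sym_mats) (rule sym_mats_transpose[OF A])
  obtain P\<^sub>1 where P1: "pos_def V\<^sub>1 P\<^sub>1" "\<forall>i\<in>V\<^sub>1. A $ i $ i = P\<^sub>1 $ i $ i"
      "\<forall>i j. {i, j} \<in> E\<^sub>1 \<longrightarrow> A $ i $ j = P\<^sub>1 $ i $ j"
    using c(1) simple_graph_edge[OF g(1)] unfolding completable_iff[OF g(1) bs] by (auto simp: block_nth)
  obtain P\<^sub>2 where P2: "pos_def V\<^sub>2 P\<^sub>2" "\<forall>i\<in>V\<^sub>2. A $ i $ i = P\<^sub>2 $ i $ i"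
      "\<forall>i j. {i, j} \<in> E\<^sub>2 \<longrightarrow> A $ i $ j = P\<^sub>2 $ i $ j"
    using c(2) simple_graph_edge[OF g(2)] unfolding completable_iff[OF g(2) bs] by (auto simp: block_nth)
  have "A $ i $ j = P\<^sub>1 $ i $ j \<and> A $ i $ j = P\<^sub>2 $ i $ j" if "i \<in> V\<^sub>1 \<inter> V\<^sub>2" "j \<in> V\<^sub>1 \<inter> V\<^sub>2" for i j
    using that cl P1(2,3) P2(2,3) unfolding induces_clique_def by (metis IntE)
  then have "block (V\<^sub>1 \<inter> V\<^sub>2) P\<^sub>1 = block (V\<^sub>1 \<inter> V\<^sub>2) P\<^sub>2"
    unfolding vec_eq_iff block_nth by metis
  then obtain P where P: "pos_def (V\<^sub>1 \<union> V\<^sub>2) P" "block V\<^sub>1 P = P\<^sub>1" "block V\<^sub>2 P = P\<^sub>2"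
    using pos_def_glue[OF P1(1) P2(1)] by blast
  have P1': "P\<^sub>1 $ i $ j = P $ i $ j" if "i \<in> V\<^sub>1" "j \<in> V\<^sub>1" for i j
    using that by (simp add: block_nth flip: P(2))
  have P2': "P\<^sub>2 $ i $ j = P $ i $ j" if "i \<in> V\<^sub>2" "j \<in> V\<^sub>2" for i j
    using that by (simp add: block_nth flip: P(3))
  have gs: "simple_graph (V\<^sub>1 \<union> V\<^sub>2) (E\<^sub>1 \<union> E\<^sub>2)"
    using g by (auto simp: simple_graph_def)
  show ?thesis
    unfolding completable_iff[OF gs A]
  proof (intro exI[of _ P] conjI P(1) ballI allI impI)
    show "A $ i $ i = P $ i $ i" if "i \<in> V\<^sub>1 \<union> V\<^sub>2" for i
      using that P1(2) P2(2) P1' P2' by auto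
    show "A $ i $ j = P $ i $ j" if "{i, j} \<in> E\<^sub>1 \<union> E\<^sub>2" for i j
      using that P1(3) P2(3) P1' P2' simple_graph_edge[OF g(1)] simple_graph_edge[OF g(2)]
      by (metis UnE)
  qed
qed

text \<open>A proper subvariety lies in the zero set of a single polynomial that is nonzero
  somewhere on the rank variety. In this form exceptional sets combine by multiplication and pull
  back along polynomial maps.\<close>

lemma almost_all_completable_iff:
  "almost_all_completable V E r \<longleftrightarrow>
    (\<exists>f. real_polynomial_function f \<and> (\<exists>A\<in>rank_variety V r. f A \<noteq> 0) \<and>
      (\<forall>A. pos_semidef V A \<longrightarrow> rank A = r \<longrightarrow> \<not> completable V E A \<longrightarrow> f A = 0))"
  (is "?L \<longleftrightarrow> ?R")
proof
  assume ?L
  then obtain X F where F: "\<forall>f\<in>F. real_polynomial_function f"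
    and X: "X = {x \<in> rank_variety V r. \<forall>f\<in>F. f x = 0}" "X \<noteq> rank_variety V r"
    and bad: "\<And>A. pos_semidef V A \<Longrightarrow> rank A = r \<Longrightarrow> \<not> completable V E A \<Longrightarrow> A \<in> X"
    unfolding almost_all_completable_def proper_subvariety_def completable_def by blast
  obtain A f where "A \<in> rank_variety V r" "f \<in> F" "f A \<noteq> 0" using X by blast
  then show ?R using F X(1) bad by (intro exI[of _ f]) blast
next
  assume ?R
  then obtain f where f: "real_polynomial_function f" "\<exists>A\<in>rank_variety V r. f A \<noteq> 0"
    "\<And>A. pos_semidef V A \<Longrightarrow> rank A = r \<Longrightarrow> \<not> completable V E A \<Longrightarrow> f A = 0" by blast
  define X where "X = {x \<in> rank_variety V r. \<forall>f\<in>{f}. f x = 0}"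
  have "proper_subvariety X (rank_variety V r)"
    unfolding proper_subvariety_def using f(1,2)
    by (intro conjI exI[of _ "{f}"]) (auto simp: X_def)
  moreover have "{A. pos_semidef V A \<and> rank A = r \<and>
           \<not> (\<exists>P. pos_def V P \<and> graph_proj V E A = graph_proj V E P)} \<subseteq> X"
    using f(3) by (auto simp: X_def rank_variety_def pos_semidef_def completable_def)
  ultimately show ?L unfolding almost_all_completable_def by blast
qed

text \<open>Vacuous, since no matrix on \<open>V\<close> has rank \<open>r\<close>; the zero matrix
  \<open>coord_proj {}\<close> shows that the constant polynomial 1 is nonzero somewhere on the
  variety.\<close>

lemma almost_all_completable_gt_card:
  assumes "card V < r"
  shows "almost_all_completable V E r"
proof -
  have "coord_proj {} \<in> rank_variety V r" by (rule coord_proj_rank_variety) auto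
  moreover have "rank A \<noteq> r" if "pos_semidef V A" for A
    using that rank_le_card[of A V] assms by (auto simp: pos_semidef_def)
  ultimately show ?thesis
    unfolding almost_all_completable_iff by (intro exI[of _ "\<lambda>_. 1"]) auto
qed

subsection \<open>Subgraphs\<close>

lemma right_factor_if_range_subset:
  fixes A :: "real^'n^'m" and B :: "real^'p^'m"
  assumes "range ((*v) A) \<subseteq> range ((*v) B)"
  obtains M where "A = B ** M"
proof -
  have "\<exists>y. A *v axis j 1 = B *v y" for j using assms by blast
  then obtain y where y: "\<And>j. A *v axis j 1 = B *v y j" by metis
  define M :: "real^'n^'p" where "M = (\<chi> i j. y j $ i)"
  have "column j A = B *v column j M" for j
    using y[of j] by (simp add: matrix_vector_mult_basis M_def column_def)
  then have "A = B ** M"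
    by (simp add: vec_eq_iff column_def matrix_matrix_mult_def matrix_vector_mult_def)
  then show ?thesis using that by blast
qed

text \<open>A generic \<open>A\<close> is determined by its \<open>V'\<close> block through
  \<open>A = L (block V' A) L^T\<close>. With this \<open>L\<close> fixed, every \<open>B\<close> on
  \<open>V'\<close> extends to a matrix of the same rank with \<open>V'\<close> block
  \<open>B\<close>, so a bad \<open>B\<close> has a bad extension and \<open>f\<close> pulls back to
  a polynomial that is nonzero at \<open>block V' A\<close>.\<close>

lemma almost_all_completable_subgraph:
  fixes V V' :: "'n::finite set"
  assumes g: "simple_graph V E" "simple_graph V' E'" "V' \<subseteq> V" "E' \<subseteq> E"
    and G: "almost_all_completable V E r"
  shows "almost_all_completable V' E' r"
proof (cases "card V' < r")
  case True
  then show ?thesis by (rule almost_all_completable_gt_card)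
next
  case False
  then obtain R where R: "R \<subseteq> V'" "card R = r"
    by (metis not_less obtain_subset_with_card_n)
  have rn: "r \<le> CARD('n)" using R(2) by (metis card_mono finite subset_UNIV)
  obtain f A\<^sub>0 where f: "real_polynomial_function f" "A\<^sub>0 \<in> rank_variety V r" "f A\<^sub>0 \<noteq> 0"
    "\<And>A. pos_semidef V A \<Longrightarrow> rank A = r \<Longrightarrow> \<not> completable V E A \<Longrightarrow> f A = 0"
    using G unfolding almost_all_completable_iff by blast
  have "coord_proj R \<in> rank_variety V r"
    using R g(3) by (intro coord_proj_rank_variety) auto
  then obtain A where A: "A \<in> rank_variety V r" "f A \<noteq> 0" "minor R A \<noteq> 0"
    using rank_variety_irreducible[OF rn f(1-3) real_polynomial_function_minor]
    by (metis minor_coord_proj zero_neq_one)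
  have sA: "A \<in> sym_mats V" and rA: "rank A \<le> r" using A(1) by (auto simp: rank_variety_def)
  define p where "p = coord_proj V'"
  define u where "u = coord_proj V"
  have pu: "p ** u = p" "u ** p = p" "p ** p = p" "u ** u = u"
    using g(3) by (auto simp: p_def u_def coord_proj_mult Int_absorb1 Int_absorb2)
  \<comment> \<open>The nonzero minor forces the columns in \<open>V'\<close> to span the whole
    range of \<open>A\<close>, so the remaining columns are combinations of them.\<close>
  have "r \<le> rank (block V' A)" using minor_nonzero_rank[OF A(3) R(1)] R(2) by simp
  also have "\<dots> \<le> rank (A ** p)"
    unfolding block_def p_def by (metis matrix_mul_assoc rank_mul_le_right)
  finally have "rank A \<le> rank (A ** p)" using rA by simp
  then have "range ((*v) (A ** p)) = range ((*v) A)"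
    unfolding rank_dim_range
    by (intro subspace_dim_equal linear_subspace_image matrix_vector_mul_linear subspace_UNIV)
      (auto simp flip: matrix_vector_mul_assoc)
  then obtain M where M: "A = A ** p ** M"
    using right_factor_if_range_subset[of A "A ** p"] by auto
  \<comment> \<open>\<open>L\<close> reconstructs \<open>A\<close> from its \<open>V'\<close> rows while \<open>p ** L = p\<close> keeps the \<open>V'\<close> block unchanged.\<close>
  define L where "L = p + (u - p) ** transpose M"
  have MA: "transpose M ** p ** A = A"
    using arg_cong[OF M, of transpose] sym_mats_transpose[OF sA]
    by (simp add: matrix_transpose_mul p_def matrix_mul_assoc)
  have "L ** p ** A = p ** p ** A + (u - p) ** (transpose M ** p ** A)"
    by (simp add: L_def matrix_add_rdistrib matrix_mul_assoc)
  also have "\<dots> = A"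
    using sym_mats_proj_left[OF sA] by (simp add: MA matrix_diff_rdistrib pu flip: u_def)
  finally have LA: "L ** p ** A = A" .
  have LA': "A ** p ** transpose L = A"
    using arg_cong[OF LA, of transpose] sym_mats_transpose[OF sA]
    by (simp add: matrix_transpose_mul p_def matrix_mul_assoc)
  have uL: "u ** L = L" and pL: "p ** L = p"
    by (simp_all add: L_def matrix_add_ldistrib matrix_diff_ldistrib matrix_mul_assoc pu)
  have pL': "transpose L ** p = p"
    using arg_cong[OF pL, of transpose] by (simp add: matrix_transpose_mul p_def)
  define h where "h B = f (L ** B ** transpose L)" for B
  show ?thesis
    unfolding almost_all_completable_iff
  proof (intro exI[of _ h] conjI allI impI)
    show "real_polynomial_function h"
      unfolding h_def by (intro real_polynomial_function_comp[OF f(1)] polynomial_function_matrix_mult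
          polynomial_function_const polynomial_function_id)
    have "L ** block V' A ** transpose L = L ** p ** A ** p ** transpose L"
      unfolding block_def p_def by (simp add: matrix_mul_assoc)
    then have "h (block V' A) \<noteq> 0"
      unfolding h_def using LA LA' A(2) by simp
    moreover have "block V' A \<in> rank_variety V' r"
      using rA rank_block_le[of V' A] block_sym_mats[OF sym_mats_transpose[OF sA]]
      by (auto simp: rank_variety_def intro: order.trans)
    ultimately show "\<exists>A\<in>rank_variety V' r. h A \<noteq> 0" by blast
  next
    fix B assume B: "pos_semidef V' B" "rank B = r" "\<not> completable V' E' B"
    have sB: "B \<in> sym_mats V'" using B(1) by (simp add: pos_semidef_def)
    define B' where "B' = L ** B ** transpose L"
    have psd: "pos_semidef V B'"
      unfolding B'_def using B(1) uL[unfolded u_def] by (rule pos_semidef_congruence)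
    have "block V' B' = (p ** L) ** B ** (transpose L ** p)"
      unfolding block_def B'_def p_def by (simp add: matrix_mul_assoc)
    then have bB: "block V' B' = B"
      using block_id[OF sB] by (simp only: pL pL') (simp add: block_def p_def)
    \<comment> \<open>The product bounds the rank from above; the block \<open>B\<close> inside
      \<open>B'\<close> bounds it from below.\<close>
    have "rank B' \<le> rank B"
      unfolding B'_def by (meson rank_mul_le_left rank_mul_le_right order.trans)
    then have "rank B' = r"
      using rank_block_le[of V' B'] B(2) bB by simp
    moreover have "\<not> completable V E B'"
      using completable_subgraph[OF g, of B'] B(3) bB psd by (auto simp: pos_semidef_def)
    ultimately show "h B = 0"
      using f(4)[OF psd] by (simp add: h_def B'_def)
  qed
qed

subsection \<open>Monotonicity in the rank\<close>

definition outer :: "real^'n \<Rightarrow> real^'n^'n" where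
  "outer v = (\<chi> i j. v $ i * v $ j)"

lemma outer_mult_vec: "outer v *v x = (v \<bullet> x) *\<^sub>R v"
  by (simp add: outer_def vec_eq_iff matrix_vector_mult_def inner_vec_def sum_distrib_left mult.commute mult.left_commute)

lemma transpose_outer: "transpose (outer v) = outer v"
  by (simp add: outer_def vec_eq_iff transpose_def mult.commute)

lemma outer_sym_mats: "coord_proj V *v v = v \<Longrightarrow> outer v \<in> sym_mats V"
  using transpose_outer by (auto simp: sym_mats_def outer_def simp flip: supported_iff)

lemma inner_outer: "x \<bullet> (outer v *v x) = (v \<bullet> x)\<^sup>2"
  by (simp add: outer_mult_vec power2_eq_square inner_commute)

lemma rank_add_outer_le: "rank (A + outer v) \<le> rank A + 1"
proof -
  have "range ((*v) (A + outer v)) \<subseteq> span (insert v (range ((*v) A)))"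
  proof -
    have "A *v x + (v \<bullet> x) *\<^sub>R v \<in> span (insert v (range ((*v) A)))" for x
      by (intro span_add span_mul) (auto intro: span_base)
    then show ?thesis by (auto simp: matrix_vector_mult_add_rdistrib outer_mult_vec)
  qed
  then have "rank (A + outer v) \<le> dim (insert v (range ((*v) A)))"
    unfolding rank_dim_range by (metis dim_span dim_subset)
  also have "\<dots> \<le> rank A + 1" by (simp add: dim_insert rank_dim_range)
  finally show ?thesis .
qed

lemma rank_scaleR: "c \<noteq> 0 \<Longrightarrow> rank (c *\<^sub>R A) = rank (A :: real^'n^'n)"
proof -
  have le: "rank (c *\<^sub>R A) \<le> rank A" for c and A :: "real^'n^'n"
  proof -
    have "c *\<^sub>R A = (c *\<^sub>R mat 1) ** A"
      by (simp flip: scalar_matrix_assoc)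
    then show ?thesis by (metis rank_mul_le_right)
  qed
  assume "c \<noteq> 0"
  then have "rank A = rank ((1 / c) *\<^sub>R (c *\<^sub>R A))" by simp
  then show ?thesis using le le by (metis order_antisym)
qed

text \<open>Scaled by \<open>x\<^sup>T A x\<close> so as to be polynomial in \<open>A\<close>; completability is invariant under positive scaling.\<close>

definition deflate :: "real^'n \<Rightarrow> real^'n^'n \<Rightarrow> real^'n^'n" where
  "deflate x A = (x \<bullet> (A *v x)) *\<^sub>R A - outer (A *v x)"

lemma polynomial_function_deflate:
  fixes x :: "real^'n"
  shows "polynomial_function (deflate x)"
proof -
  have v: "real_polynomial_function (\<lambda>A :: real^'n^'n. (A *v x) $ i)" for i
    unfolding matrix_vector_mult_def
    by (simp, intro real_polynomial_function_sum real_polynomial_function.intros(2,4)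
        polynomial_function_matrix_nth polynomial_function_id) simp
  have q: "real_polynomial_function (\<lambda>A :: real^'n^'n. x \<bullet> (A *v x))"
    unfolding inner_vec_def inner_real_def
    by (intro real_polynomial_function_sum real_polynomial_function.intros(2,4) v) simp
  show ?thesis
    by (rule polynomial_function_matrixI)
      (simp add: deflate_def outer_def, intro real_polynomial_function_diff real_polynomial_function.intros(4) v q
        polynomial_function_matrix_nth polynomial_function_id)
qed

text \<open>Adding back the rank-one term gives one bound. For the other, the deflated range lies in
  the range of \<open>A\<close> and is orthogonal to \<open>x\<close>, which \<open>A *v x\<close>
  is not, so it is strictly smaller.\<close>

lemma rank_deflate:
  fixes A :: "real^'n^'n"
  assumes tA: "transpose A = A" and q: "x \<bullet> (A *v x) \<noteq> 0"
  shows "rank A = rank (deflate x A) + 1"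
proof (rule antisym)
  define q where "q = x \<bullet> (A *v x)"
  have "q *\<^sub>R A = deflate x A + outer (A *v x)" by (simp add: deflate_def q_def)
  then show "rank A \<le> rank (deflate x A) + 1"
    using rank_scaleR[of q A] rank_add_outer_le q by (metis q_def)
  have d: "deflate x A *v y = A *v (q *\<^sub>R y - ((A *v x) \<bullet> y) *\<^sub>R x)" for y
    by (simp add: deflate_def q_def matrix_vector_mult_diff_rdistrib outer_mult_vec
        matrix_vector_mult_diff_distrib matrix_vector_mult_scaleR scaleR_matrix_vector_assoc)
  have "x \<bullet> (deflate x A *v y) = 0" for y
  proof -
    have "x \<bullet> (A *v y) = (A *v x) \<bullet> y" by (metis inner_matrix_transpose tA)
    then show ?thesis
      unfolding d by (simp add: matrix_vector_mult_diff_distrib matrix_vector_mult_scaleR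
          inner_diff_right q_def)
  qed
  then have "A *v x \<notin> range ((*v) (deflate x A))" using q by auto
  moreover have "range ((*v) (deflate x A)) \<subseteq> range ((*v) A)" using d by auto
  ultimately have "range ((*v) (deflate x A)) \<subset> range ((*v) A)" by blast
  moreover have "span (range ((*v) B)) = range ((*v) B)" for B :: "real^'n^'n"
    by (simp add: linear_subspace_image)
  ultimately have "dim (range ((*v) (deflate x A))) < dim (range ((*v) A))"
    by (intro dim_psubset) metis
  then show "rank (deflate x A) + 1 \<le> rank A" by (simp add: rank_dim_range)
qed

text \<open>The range is a proper subspace of the coordinate space. A vector \<open>x\<close>
  orthogonal to it satisfies \<open>(A x) . (A x) = x . A (A x) = 0\<close> by symmetry.\<close>

lemma exists_kernel_vector:
  assumes A: "A \<in> sym_mats V" and r: "rank A < card V"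
  obtains x where "x \<noteq> 0" "coord_proj V *v x = x" "A *v x = 0"
proof -
  let ?S = "{x :: real^'a. \<forall>i. i \<notin> V \<longrightarrow> x $ i = 0}"
  have "range ((*v) A) \<subseteq> ?S"
    unfolding supported_iff using sym_mats_proj_left[OF A] by (auto simp: matrix_vector_mul_assoc)
  moreover have "dim (range ((*v) A)) \<noteq> dim ?S"
    using r by (simp add: rank_dim_range dim_supported)
  ultimately have "range ((*v) A) \<noteq> ?S" "range ((*v) A) \<subseteq> ?S" by metis+
  then have ps: "range ((*v) A) \<subset> ?S" by (rule psubsetI[rotated])
  have sA: "span (range ((*v) A)) = range ((*v) A)" by (simp add: linear_subspace_image)
  have S: "span ?S = ?S" using subspace_supported[of V] by (rule span_eq_iff[THEN iffD2])
  have "span (range ((*v) A)) \<subset> span ?S" unfolding sA S by (rule ps)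
  then obtain x where x: "x \<noteq> 0" "x \<in> span ?S" "\<And>y. y \<in> span (range ((*v) A)) \<Longrightarrow> orthogonal x y"
    by (rule orthogonal_to_subspace_exists_gen) blast
  have "x \<bullet> (A *v (A *v x)) = 0"
    using x(3) by (simp add: orthogonal_def span_base)
  then have "(A *v x) \<bullet> (A *v x) = 0"
    by (metis inner_matrix_transpose sym_mats_transpose[OF A])
  then have "A *v x = 0" by simp
  moreover have "x \<in> ?S" using x(2) unfolding S .
  then have "coord_proj V *v x = x" by (simp flip: supported_iff)
  ultimately show ?thesis using that x(1) by blast
qed

lemma almost_all_completable_Suc:
  assumes g: "simple_graph V E" and G: "almost_all_completable V E r"
  shows "almost_all_completable V E (Suc r)"
proof (cases "card V < Suc r")
  case True
  then show ?thesis by (rule almost_all_completable_gt_card)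
next
  case False
  obtain f A where f: "real_polynomial_function f" "A \<in> rank_variety V r" "f A \<noteq> 0"
    "\<And>A. pos_semidef V A \<Longrightarrow> rank A = r \<Longrightarrow> \<not> completable V E A \<Longrightarrow> f A = 0"
    using G unfolding almost_all_completable_iff by blast
  have A: "A \<in> sym_mats V" "rank A \<le> r" using f(2) by (auto simp: rank_variety_def)
  \<comment> \<open>Here \<open>rank A \<le> r < card V\<close>. Deflating in a kernel direction of
    \<open>A\<close> lets \<open>A\<close> be recovered exactly from
    \<open>A + outer x\<close>.\<close>
  obtain y where y: "y \<noteq> 0" "coord_proj V *v y = y" "A *v y = 0"
    using exists_kernel_vector[OF A(1)] A(2) False by auto
  define x where "x = (1 / norm y) *\<^sub>R y"
  have x: "x \<bullet> x = 1" "coord_proj V *v x = x" "A *v x = 0"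
    using y by (simp_all add: x_def matrix_vector_mult_scaleR power2_norm_eq_inner[symmetric] power2_eq_square)
  \<comment> \<open>The first factor discards the matrices whose deflation along \<open>x\<close>
    need not lower the rank by one.\<close>
  define h where "h B = x \<bullet> (B *v x) * f (deflate x B)" for B
  show ?thesis
    unfolding almost_all_completable_iff
  proof (intro exI[of _ h] conjI allI impI)
    have "bounded_linear (\<lambda>B. x \<bullet> (B *v x))"
      by (intro linear_conv_bounded_linear[THEN iffD1] linearI)
        (simp_all add: matrix_vector_mult_add_rdistrib inner_add_right flip: scaleR_matrix_vector_assoc)
    then show "real_polynomial_function h"
      unfolding h_def
      by (intro real_polynomial_function.intros(1,4) real_polynomial_function_comp[OF f(1)] polynomial_function_deflate)
    define B where "B = A + outer x"
    have Bx: "B *v x = x"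
      using x by (simp add: B_def matrix_vector_mult_add_rdistrib outer_mult_vec)
    have "deflate x B = A" by (simp add: deflate_def Bx x) (simp add: B_def)
    then have "h B \<noteq> 0" using f(3) by (simp add: h_def Bx x)
    moreover have "B \<in> rank_variety V (Suc r)"
      using A outer_sym_mats[OF x(2)] rank_add_outer_le[of A x]
      by (auto simp: rank_variety_def B_def sym_mats_iff transpose_add matrix_add_ldistrib)
    ultimately show "\<exists>A\<in>rank_variety V (Suc r). h A \<noteq> 0" by blast
  next
    fix B assume B: "pos_semidef V B" "rank B = Suc r" "\<not> completable V E B"
    define q where "q = x \<bullet> (B *v x)"
    show "h B = 0"
    proof (cases "q = 0")
      case True
      then show ?thesis by (simp add: h_def q_def)
    next
      case False
      then have q: "q > 0" using pos_semidefD[OF B(1), of x] by (simp add: q_def)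
      have sB: "B \<in> sym_mats V" using B(1) by (simp add: pos_semidef_def)
      define D where "D = deflate x B"
      have D: "D = q *\<^sub>R B - outer (B *v x)" by (simp add: D_def deflate_def q_def)
      have oB: "outer (B *v x) \<in> sym_mats V"
        using sym_mats_proj_left[OF sB] by (intro outer_sym_mats) (simp add: matrix_vector_mul_assoc)
      have sD: "D \<in> sym_mats V"
        using sB oB unfolding D sym_mats_def by (simp add: vec_eq_iff transpose_def)
      have "0 \<le> z \<bullet> (D *v z)" for z
      proof -
        have "z \<bullet> (D *v z) = q * (z \<bullet> (B *v z)) - ((B *v x) \<bullet> z)\<^sup>2"
          by (simp add: D matrix_vector_mult_diff_rdistrib inner_diff_right inner_outer
              flip: scaleR_matrix_vector_assoc)
        then show ?thesis
          using pos_semidef_Cauchy_Schwarz[OF B(1), of x z] q by (simp add: q_def inner_commute)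
      qed
      then have psd: "pos_semidef V D" using sD by (simp add: pos_semidef_iff)
      have rD: "rank D = r"
        using rank_deflate[OF sym_mats_transpose[OF sB], of x] q B(2) by (simp add: D_def q_def)
      have "\<not> completable V E D"
      proof
        assume "completable V E D"
        then obtain P where P: "pos_def V P" "\<forall>i\<in>V. D $ i $ i = P $ i $ i"
            "\<forall>i j. {i, j} \<in> E \<longrightarrow> D $ i $ j = P $ i $ j"
          using completable_iff[OF g sD] by blast
        \<comment> \<open>Inverts the deflation \<open>D = q B - outer (B x)\<close> with
          \<open>P\<close> in place of \<open>D\<close>; adding a semidefinite term and dividing by
          \<open>q > 0\<close> preserves definiteness.\<close>
        define P' where "P' = (1 / q) *\<^sub>R (P + outer (B *v x))"
        have "P' \<in> sym_mats V"
          using P(1) oB unfolding P'_def pos_def_def sym_mats_def by (simp add: vec_eq_iff transpose_def)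
        moreover have "0 < z \<bullet> (P' *v z)" if "\<forall>i. i \<notin> V \<longrightarrow> z $ i = 0" "z \<noteq> 0" for z
        proof -
          have "z \<bullet> (P' *v z) = (1 / q) * (z \<bullet> (P *v z) + ((B *v x) \<bullet> z)\<^sup>2)"
            by (simp add: P'_def matrix_vector_mult_add_rdistrib inner_add_right inner_outer
              flip: scaleR_matrix_vector_assoc)
          moreover have "0 < z \<bullet> (P *v z)" using P(1) that by (simp add: pos_def_def)
          ultimately show ?thesis using q by (simp add: add_pos_nonneg)
        qed
        ultimately have "pos_def V P'" by (simp add: pos_def_def)
        moreover have "B $ i $ j = P' $ i $ j" if "D $ i $ j = P $ i $ j" for i j
          using that q by (simp add: P'_def D field_simps)
        ultimately have "completable V E B"
          unfolding completable_iff[OF g sB] using P by blast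
        then show False using B(3) by blast
      qed
      then show ?thesis using f(4)[OF psd rD] by (simp add: h_def D_def)
    qed
  qed
qed

lemma almost_all_completable_mono:
  assumes "simple_graph V E" and "almost_all_completable V E r" and "r \<le> s"
  shows "almost_all_completable V E s"
  using assms(3,2) by (induction s rule: dec_induct) (auto intro: almost_all_completable_Suc[OF assms(1)])

subsection \<open>Clique sums\<close>

text \<open>Carries genericity from matrices on \<open>V\<close> to \<open>V\<close> blocks of
  matrices on \<open>W\<close>. A block could drop in rank, where \<open>f\<close> says nothing, so
  a nonzero minor is imposed as well.\<close>

lemma completable_block_generic:
  assumes g: "simple_graph V E" and "almost_all_completable V E r" and VW: "V \<subseteq> W"
  obtains f where "real_polynomial_function f" "\<exists>A\<in>rank_variety W r. f A \<noteq> 0"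
    "\<And>A. pos_semidef W A \<Longrightarrow> rank A = r \<Longrightarrow> f A \<noteq> 0 \<Longrightarrow> completable V E (block V A)"
proof (cases "card V < r")
  case True
  \<comment> \<open>Here the block is too small to have rank \<open>r\<close>; generically it is
    positive definite and is its own completion.\<close>
  have "completable V E (block V A)" if "pos_semidef W A" "minor V A \<noteq> 0" for A
    using minor_nonzero_pos_def[OF that(2,1)] unfolding completable_def by blast
  moreover have "coord_proj V \<in> rank_variety W r"
    using VW True by (intro coord_proj_rank_variety) auto
  ultimately show ?thesis
    using real_polynomial_function_minor that[of "minor V"] by (metis minor_coord_proj zero_neq_one)
next
  case False
  then obtain R where R: "R \<subseteq> V" "card R = r"
    by (metis not_less obtain_subset_with_card_n)
  have rn: "r \<le> CARD('a)" using R(2) by (metis card_mono finite subset_UNIV)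
  obtain f A where f: "real_polynomial_function f" "A \<in> rank_variety V r" "f A \<noteq> 0"
    "\<And>A. pos_semidef V A \<Longrightarrow> rank A = r \<Longrightarrow> \<not> completable V E A \<Longrightarrow> f A = 0"
    using assms(2) unfolding almost_all_completable_iff by blast
  have A: "A \<in> rank_variety W r" "f (block V A) \<noteq> 0"
    using f(2,3) VW by (auto simp: rank_variety_def block_id intro: sym_mats_mono)
  have poly: "real_polynomial_function (\<lambda>A. f (block V A))"
    unfolding block_def by (intro real_polynomial_function_comp[OF f(1)] polynomial_function_matrix_mult
          polynomial_function_const polynomial_function_id)
  have R': "coord_proj R \<in> rank_variety W r"
    using R VW by (intro coord_proj_rank_variety) auto
  obtain C where C: "C \<in> rank_variety W r" "f (block V C) \<noteq> 0" "minor R C \<noteq> 0"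
    using rank_variety_irreducible[OF rn poly A real_polynomial_function_minor R']
    by (metis minor_coord_proj zero_neq_one)
  show ?thesis
  proof (rule that[of "\<lambda>A. f (block V A) * minor R A"])
    show "real_polynomial_function (\<lambda>A. f (block V A) * minor R A)"
      by (intro real_polynomial_function.intros(4) poly real_polynomial_function_minor)
    show "\<exists>A\<in>rank_variety W r. f (block V A) * minor R A \<noteq> 0" using C by auto
    fix B assume B: "pos_semidef W B" "rank B = r" "f (block V B) * minor R B \<noteq> 0"
    \<comment> \<open>The minor on the \<open>r\<close>-element set \<open>R\<close> keeps the rank
      of the block exactly \<open>r\<close>, so the genericity hypothesis on \<open>V\<close>
      applies.\<close>
    have "r \<le> rank (block V B)" using minor_nonzero_rank[of R B V] R B(3) by auto
    then have "rank (block V B) = r" using rank_block_le[of V B] B(2) by simp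
    then show "completable V E (block V B)"
      using f(4)[OF pos_semidef_block[OF B(1)]] B(3) by auto
  qed
qed

text \<open>Off the zeros of \<open>f\<^sub>1 * f\<^sub>2\<close> both blocks are completable and
  the completions glue. Irreducibility keeps the product from vanishing on the whole
  variety.\<close>

lemma almost_all_completable_clique_sum:
  fixes V\<^sub>1 V\<^sub>2 :: "'n::finite set"
  assumes g: "simple_graph V\<^sub>1 E\<^sub>1" "simple_graph V\<^sub>2 E\<^sub>2"
    and cl: "induces_clique E\<^sub>1 (V\<^sub>1 \<inter> V\<^sub>2)" "induces_clique E\<^sub>2 (V\<^sub>1 \<inter> V\<^sub>2)"
    and G: "almost_all_completable V\<^sub>1 E\<^sub>1 r" "almost_all_completable V\<^sub>2 E\<^sub>2 r"
  shows "almost_all_completable (V\<^sub>1 \<union> V\<^sub>2) (E\<^sub>1 \<union> E\<^sub>2) r"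
proof (cases "card (V\<^sub>1 \<union> V\<^sub>2) < r")
  case True
  then show ?thesis by (rule almost_all_completable_gt_card)
next
  case False
  then have rn: "r \<le> CARD('n)" by (meson card_mono finite not_less order.trans subset_UNIV)
  let ?W = "V\<^sub>1 \<union> V\<^sub>2"
  obtain f\<^sub>1 A\<^sub>1 where f1: "real_polynomial_function f\<^sub>1" "A\<^sub>1 \<in> rank_variety ?W r" "f\<^sub>1 A\<^sub>1 \<noteq> 0"
    "\<And>A. pos_semidef ?W A \<Longrightarrow> rank A = r \<Longrightarrow> f\<^sub>1 A \<noteq> 0 \<Longrightarrow> completable V\<^sub>1 E\<^sub>1 (block V\<^sub>1 A)"
    using completable_block_generic[OF g(1) G(1), of ?W] by blast
  obtain f\<^sub>2 A\<^sub>2 where f2: "real_polynomial_function f\<^sub>2" "A\<^sub>2 \<in> rank_variety ?W r" "f\<^sub>2 A\<^sub>2 \<noteq> 0"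
    "\<And>A. pos_semidef ?W A \<Longrightarrow> rank A = r \<Longrightarrow> f\<^sub>2 A \<noteq> 0 \<Longrightarrow> completable V\<^sub>2 E\<^sub>2 (block V\<^sub>2 A)"
    using completable_block_generic[OF g(2) G(2), of ?W] by blast
  obtain C where C: "C \<in> rank_variety ?W r" "f\<^sub>1 C \<noteq> 0" "f\<^sub>2 C \<noteq> 0"
    using rank_variety_irreducible[OF rn f1(1-3) f2(1-3)] .
  show ?thesis
    unfolding almost_all_completable_iff
  proof (intro exI[of _ "\<lambda>A. f\<^sub>1 A * f\<^sub>2 A"] conjI allI impI)
    show "real_polynomial_function (\<lambda>A. f\<^sub>1 A * f\<^sub>2 A)"
      using f1(1) f2(1) by (rule real_polynomial_function.intros(4))
    show "\<exists>A\<in>rank_variety ?W r. f\<^sub>1 A * f\<^sub>2 A \<noteq> 0" using C by auto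
    show "f\<^sub>1 A * f\<^sub>2 A = 0" if "pos_semidef ?W A" "rank A = r" "\<not> completable ?W (E\<^sub>1 \<union> E\<^sub>2) A" for A
      using completable_clique_sum[OF g cl] f1(4) f2(4) that by (metis mult_eq_0_iff pos_semidef_def)
  qed
qed

text \<open>The least element exists because every rank above \<open>card V\<close> qualifies;
  \<open>Suc (card V)\<close> is the witness.\<close>

lemma almost_all_completable_mlt: "almost_all_completable V E (mlt V E)"
  unfolding mlt_def by (rule LeastI[OF almost_all_completable_gt_card]) (rule lessI)

lemma mlt_le: "almost_all_completable V E r \<Longrightarrow> mlt V E \<le> r"
  unfolding mlt_def by (rule Least_le)

theorem theorem1p14:
  fixes V\<^sub>1 V\<^sub>2 :: "'n::finite set" and E\<^sub>1 E\<^sub>2 :: "'n set set"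
  assumes "simple_graph V\<^sub>1 E\<^sub>1" and "simple_graph V\<^sub>2 E\<^sub>2"
    and "induces_clique E\<^sub>1 (V\<^sub>1 \<inter> V\<^sub>2)" and "induces_clique E\<^sub>2 (V\<^sub>1 \<inter> V\<^sub>2)"
  shows "mlt (V\<^sub>1 \<union> V\<^sub>2) (E\<^sub>1 \<union> E\<^sub>2) = max (mlt V\<^sub>1 E\<^sub>1) (mlt V\<^sub>2 E\<^sub>2)"
proof (rule antisym)
  let ?r = "max (mlt V\<^sub>1 E\<^sub>1) (mlt V\<^sub>2 E\<^sub>2)"
  \<comment> \<open>Monotonicity in the rank brings both graphs to the common rank
    \<open>?r\<close>, where the clique sum result applies.\<close>
  have "almost_all_completable V\<^sub>1 E\<^sub>1 ?r" "almost_all_completable V\<^sub>2 E\<^sub>2 ?r"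
    using assms(1,2) by (auto intro: almost_all_completable_mono almost_all_completable_mlt)
  then show "mlt (V\<^sub>1 \<union> V\<^sub>2) (E\<^sub>1 \<union> E\<^sub>2) \<le> ?r"
    by (intro mlt_le almost_all_completable_clique_sum assms)
  have g: "simple_graph (V\<^sub>1 \<union> V\<^sub>2) (E\<^sub>1 \<union> E\<^sub>2)"
    using assms(1,2) by (auto simp: simple_graph_def)
  have "mlt V\<^sub>1 E\<^sub>1 \<le> mlt (V\<^sub>1 \<union> V\<^sub>2) (E\<^sub>1 \<union> E\<^sub>2)" "mlt V\<^sub>2 E\<^sub>2 \<le> mlt (V\<^sub>1 \<union> V\<^sub>2) (E\<^sub>1 \<union> E\<^sub>2)"
    by (rule mlt_le, rule almost_all_completable_subgraph[OF g _ _ _ almost_all_completable_mlt];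
        use assms in simp)+
  then show "?r \<le> mlt (V\<^sub>1 \<union> V\<^sub>2) (E\<^sub>1 \<union> E\<^sub>2)" by simp
qed

end
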